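(* Let $H=(V,E)$ be a finite $3$-uniform hypergraph with $V\neq\emptyset$ such that $d^+(v)\ge 3$ for all $v\in V$. Then $H$ contains a linear cycle.
   Context: A finite $3$-uniform hypergraph $H=(V,E)$ consists of a finite vertex set $V$ and a set $E$ of $3$-element subsets of $V$ (edges). For $v\in V$, the link of $v$ is the graph with vertex set $V$ and edge set $\{\{x,y\}: \{v,x,y\}\in E\}$. The strong degree $d^+(v)$ is the maximum number of pairwise disjoint edges in the link of $v$. A linear cycle in $H$ is a set of $k\ge 3$ edges of the form $\{v_i,w_i,v_{i+1}\}$, $i=1,\dots,k$ (indices modulo $k$), where $v_1,\dots,v_k,w_1,\dots,w_k$ are $2k$ distinct vertices. Thus only cyclically consecutive edges intersect, they intersect in exactly one vertex, and these intersection vertices are distinct. *)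

theory Defs
  imports Main "HOL-Library.Disjoint_Sets"
begin

definition hypergraph3 :: "'a set \<Rightarrow> 'a set set \<Rightarrow> bool" where
  "hypergraph3 V E \<longleftrightarrow> finite V \<and> (\<forall>e\<in>E. e \<subseteq> V \<and> card e = 3)"

(* Only the edge set of the link graph is recorded; its vertex set is that of the hypergraph.
   When all members of E have cardinality 3, the witnesses x, y are distinct from each other
   and from v. *)
definition link_edges :: "'a set set \<Rightarrow> 'a \<Rightarrow> 'a set set" where
  "link_edges E v = {{x, y} | x y. {v, x, y} \<in> E}"

(* For finite E this is the maximum of a finite set of naturals containing 0 = card {}. *)
definition strong_degree :: "'a set set \<Rightarrow> 'a \<Rightarrow> nat" where
  "strong_degree E v = Max {card M | M. M \<subseteq> link_edges E v \<and> disjoint M}"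

(* Indices run over 0, ..., k - 1 rather than 1, ..., k. The distinctness conditions say that
   the 2k vertices v i, w i (i < k) are distinct, so C automatically has exactly k members. *)
definition linear_cycle :: "'a set set \<Rightarrow> bool" where
  "linear_cycle C \<longleftrightarrow>
    (\<exists>k v w. 3 \<le> k \<and>
      inj_on v {..<k} \<and> inj_on w {..<k} \<and> v ` {..<k} \<inter> w ` {..<k} = {} \<and>
      C = {{v i, w i, v ((i + 1) mod k)} | i. i < (k::nat)})"

end

(* Suppose there is no linear cycle. A linear path that cannot be extended at its tip a has, since
   a has strong degree 3, an edge {a, w, z} where w is the middle vertex and z the vertex towards
   the root of an edge {v, w, z} of the path (an edge at a that meets the path otherwise, but avoids
   the other two vertices of its first edge, closes a linear cycle): the path "lands" at z. The root part R of a path is good if no proper extension of R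
   lands inside R. Among the landings of the extensions of a good R take the one closest to the
   root, at z and with middle vertex w. The two edges containing {w, z} and the part of the path
   beyond them form a "handle". Passing from z to w by one of these two edges, or, when the handle
   spans only five vertices, by two edges inside it, gives a longer path ending at w that is good
   again. So there are good paths of every length, which is absurd in a finite hypergraph. *)

theory Submission
  imports Defs
begin

section \<open>Linear paths\<close>

(* A linear path is the list v1, w1, v2, w2, ..., vm of its vertices, with edges {vi, wi, v(i+1)}.
   Its head is the free tip, its last vertex the root. Distinctness is required separately. *)
fun lpath :: "'a set set \<Rightarrow> 'a list \<Rightarrow> bool" where
  "lpath E [] = False"
| "lpath E [a] = True"
| "lpath E [a, b] = False"
| "lpath E (a # b # c # xs) = ({a, b, c} \<in> E \<and> lpath E (c # xs))"

lemma lpath_odd: "lpath E xs \<Longrightarrow> odd (length xs)"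
  by (induction E xs rule: lpath.induct) auto

lemma lpath_append:
  "odd (length xs) \<Longrightarrow> ys \<noteq> [] \<Longrightarrow>
    lpath E (xs @ w # ys) \<longleftrightarrow> lpath E xs \<and> {last xs, w, hd ys} \<in> E \<and> lpath E ys"
proof (induction E xs rule: lpath.induct)
  case (2 E a)
  then show ?case by (cases ys) auto
qed auto

lemma lpath_join:
  "odd (length xs) \<Longrightarrow> lpath E (xs @ ys) \<longleftrightarrow> lpath E xs \<and> lpath E (last xs # ys)"
  by (induction E xs rule: lpath.induct) auto

lemma lpath_rev: "lpath E (rev xs) \<longleftrightarrow> lpath E xs"
proof (induction E xs rule: lpath.induct)
  case (4 E a b c xs)
  show ?case
  proof (cases "even (length xs)")
    case True
    have "lpath E ((rev xs @ [c]) @ b # [a]) \<longleftrightarrow> lpath E (rev xs @ [c]) \<and> {c, b, a} \<in> E"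
      by (subst lpath_append) (use True in auto)
    with 4 show ?thesis by (auto simp: insert_commute)
  next
    case False
    then show ?thesis using lpath_odd[of E "rev (a#b#c#xs)"] lpath_odd[of E "a#b#c#xs"] by auto
  qed
qed auto

lemma lpath_nth: "lpath E xs \<Longrightarrow> 2 * i + 2 < length xs \<Longrightarrow> {xs ! (2*i), xs ! (2*i+1), xs ! (2*i+2)} \<in> E"
proof (induction E xs arbitrary: i rule: lpath.induct)
  case (4 E a b c xs)
  then show ?case by (cases i) auto
qed auto

section \<open>Closing a path to a linear cycle\<close>

lemma linear_cycle_of_list:
  assumes "lpath E ys" "distinct (u # ys)" "5 \<le> length ys" "{hd ys, u, last ys} \<in> E"
  shows "\<exists>C\<subseteq>E. linear_cycle C"
proof -
  obtain k where k: "length ys = 2 * k + 1" using lpath_odd[OF assms(1)] by (auto elim: oddE)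
  define v where "v i = ys ! (2 * i)" for i
  \<comment> \<open>The path has k edges; the closing edge gets index k and middle vertex
    \<open>u\<close>. As \<open>length ys\<close> is at least 5, these k + 1 edges are at least
    three.\<close>
  define w where "w i = (if i = k then u else ys ! (2 * i + 1))" for i
  let ?C = "{{v i, w i, v ((i + 1) mod (k + 1))} | i. i < k + 1}"
  have d: "distinct ys" "u \<notin> set ys" using assms by auto
  have "inj_on v {..<k+1}" using k d by (auto simp: inj_on_def v_def nth_eq_iff_index_eq)
  moreover have "inj_on w {..<k+1}"
  proof -
    have ne: "ys ! (2 * i + 1) \<noteq> u" if "i < k" for i
      using that k d(2) nth_mem[of "2 * i + 1" ys] by auto
    show ?thesis
    proof (rule inj_onI)
      fix i j assume "i \<in> {..<k+1}" "j \<in> {..<k+1}" "w i = w j"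
      then show "i = j" using k d(1) ne[of i] ne[of j]
        by (cases "i = k"; cases "j = k") (auto simp: w_def nth_eq_iff_index_eq)
    qed
  qed
  moreover have "v i \<noteq> w j" if "i < k + 1" "j < k + 1" for i j
  proof (cases "j = k")
    case True
    then show ?thesis using that k d by (auto simp: v_def w_def in_set_conv_nth)
  next
    case False
    \<comment> \<open>Parity: \<open>v i\<close> stands at an even position of \<open>ys\<close>,
      \<open>w j\<close> at an odd one.\<close>
    then show ?thesis using that k d by (simp add: v_def w_def nth_eq_iff_index_eq) presburger
  qed
  then have "v ` {..<k+1} \<inter> w ` {..<k+1} = {}" by blast
  ultimately have "linear_cycle ?C" unfolding linear_cycle_def
    using k assms(3) by (intro exI[of _ "k + 1"] exI[of _ v] exI[of _ w]) auto
  moreover have "{v i, w i, v ((i + 1) mod (k + 1))} \<in> E" if "i < k + 1" for i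
  proof (cases "i = k")
    case True
    have "ys \<noteq> []" using k by auto
    then show ?thesis using True assms(4) k
      by (simp add: v_def w_def hd_conv_nth last_conv_nth insert_commute)
  next
    case False
    then show ?thesis using lpath_nth[OF assms(1), of i] that k by (simp add: v_def w_def)
  qed
  then have "?C \<subseteq> E" by auto
  ultimately show ?thesis by (intro exI[of _ ?C] conjI)
qed

text \<open>Models an edge that enters \<open>L\<close> at \<open>s\<close> with \<open>t\<close> as
  its middle vertex: the path continuing it inside \<open>L\<close> may not use
  \<open>t\<close>.\<close>

definition reaches :: "'a set set \<Rightarrow> 'a list \<Rightarrow> 'a \<Rightarrow> 'a \<Rightarrow> 'a \<Rightarrow> bool" where
  "reaches E L s t z \<longleftrightarrow>
    (\<exists>K. lpath E K \<and> distinct K \<and> set K \<subseteq> set L \<and> hd K = s \<and> t \<notin> set K \<and> last K = z)"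

(* The exceptional pair {last A, w} consists of the first two vertices of an edge of L: any path
   inside L from one of them to last L that starts with this edge contains the other. *)
lemma lpath_reach_last:
  assumes "lpath E L" "distinct L" "s \<noteq> t" "s \<in> set L \<or> t \<in> set L"
  shows "reaches E L s t (last L) \<or> reaches E L t s (last L)
    \<or> (\<exists>A w B. L = A @ w # B \<and> odd (length A) \<and> B \<noteq> [] \<and> {s, t} = {last A, w})"
  using assms
proof (induction E L rule: lpath.induct)
  case (2 E a)
  have "reaches E [a] a u (last [a])" if "u \<noteq> a" for u
    unfolding reaches_def using that by (intro exI[of _ "[a]"]) auto
  then show ?case using 2 by auto
next
  case (4 E a b c xs)
  let ?L = "a # b # c # xs"
  \<comment> \<open>Swapping the first two vertices keeps the edge {a, b, c}, so a path can start at
    its middle vertex \<open>b\<close> as well as at \<open>a\<close>.\<close>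
  have whole: "reaches E ?L b' c' (last ?L)" if "b' \<in> {a, b}" "c' \<notin> set ?L" for b' c'
  proof -
    define K where "K = (if b' = a then ?L else b # a # c # xs)"
    have "lpath E K" "distinct K" "set K = set ?L" "hd K = b'" "last K = last ?L"
      using that(1) "4.prems"(1,2) by (auto simp: K_def insert_commute)
    then show ?thesis using that(2) unfolding reaches_def by blast
  qed
  have lift: "reaches E ?L b' c' (last ?L)" if "reaches E (c # xs) b' c' (last (c # xs))" for b' c'
    using that unfolding reaches_def by fastforce
  show ?case
  proof (cases "s \<in> set (c # xs) \<or> t \<in> set (c # xs)")
    case True
    have p: "lpath E (c # xs)" "distinct (c # xs)" using 4 by auto
    from 4(1)[OF p 4(4) True] show ?thesis
    proof (elim disjE exE conjE)
      fix A w B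
      assume *: "c # xs = A @ w # B" "odd (length A)" "B \<noteq> []" "{s, t} = {last A, w}"
      then have "A \<noteq> []" by auto
      then have "?L = (a # b # A) @ w # B" "odd (length (a # b # A))" "{s, t} = {last (a # b # A), w}"
        using * by auto
      with \<open>B \<noteq> []\<close> show ?thesis by blast
    qed (use lift in auto)
  next
    case nts: False
    show ?thesis
    proof (cases "s \<in> {a, b} \<and> t \<in> {a, b}")
      case True
      then have "?L = [a] @ b # c # xs" "odd (length [a])" "{s, t} = {last [a], b}"
        using 4(4) by auto
      then show ?thesis by blast
    next
      case F: False
      then show ?thesis
        using whole[of s t] whole[of t s] nts 4(5) by auto
    qed
  qed
qed auto

text \<open>Apply \<open>lpath_reach_last\<close> to \<open>rev L\<close>. Reversal turns the
  exceptional pair into the middle vertex and the rootward vertex of an edge.\<close>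

lemma lpath_reach_hd:
  assumes "lpath E L" "distinct L" "s \<noteq> t" "s \<in> set L \<or> t \<in> set L"
  shows "reaches E L s t (hd L) \<or> reaches E L t s (hd L)
    \<or> (\<exists>A w B. L = A @ w # B \<and> odd (length A) \<and> B \<noteq> [] \<and> {s, t} = {w, hd B})"
proof -
  have ne: "L \<noteq> []" using assms(1) by auto
  have "lpath E (rev L)" "distinct (rev L)" "s \<in> set (rev L) \<or> t \<in> set (rev L)"
    using assms by (auto simp: lpath_rev)
  from lpath_reach_last[OF this(1,2) assms(3) this(3)] show ?thesis
  proof (elim disjE exE conjE)
    fix A w B assume a: "rev L = A @ w # B" "odd (length A)" "B \<noteq> []" "{s, t} = {last A, w}"
    have L: "L = rev B @ w # rev A" using arg_cong[OF a(1), of rev] by simp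
    have "odd (length (rev B))" using a lpath_odd[OF assms(1)] unfolding L by auto
    moreover have "rev A \<noteq> []" "{s, t} = {w, hd (rev A)}" using a by (auto simp: hd_rev)
    ultimately show ?thesis using L by blast
  qed (use ne in \<open>auto simp: reaches_def last_rev\<close>)
qed

text \<open>A pair is exceptional for at most one end of a path: in \<open>lpath_reach_hd\<close> it
  occupies consecutive positions (counted from 0) starting at an odd one, in
  \<open>lpath_reach_last\<close> starting at an even one.\<close>

lemma odd_split_clash:
  assumes "distinct L" "L = A @ w # B" "odd (length A)" "B \<noteq> []" "L = A' @ w' # B'" "odd (length A')"
    "{w, hd B} = {last A', w'}"
  shows False
proof -
  have A': "A' \<noteq> []" using assms by auto
  then have l: "length A' > 0" "length B > 0" using assms by auto
  have w: "w = L ! length A" "hd B = L ! (length A + 1)"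
    unfolding assms(2) using assms(4) by (auto simp: nth_append hd_conv_nth)
  have w': "w' = L ! length A'"
    unfolding assms(5) by simp
  have "last A' = L ! (length A' - 1)"
    unfolding assms(5) using A' by (simp add: nth_append last_conv_nth)
  then have "{L ! length A, L ! (length A + 1)} = {L ! (length A' - 1), L ! length A'}"
    using w w' assms(7) by simp
  moreover have "length L = length A + 1 + length B" "length L = length A' + 1 + length B'"
    using arg_cong[OF assms(2), of length] arg_cong[OF assms(5), of length] by simp_all
  ultimately have "{length A, length A + 1} = {length A' - 1, length A'}"
    using assms(1) l by (auto simp: doubleton_eq_iff nth_eq_iff_index_eq)
  then show False using assms(3,6) l(1) by (auto simp: doubleton_eq_iff)
qed

text \<open>The edge {last A, s, t} is the first of the path to meet \<open>S\<close>, so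
  \<open>A\<close> can later be joined to a path inside \<open>S\<close> without repeating a
  vertex.\<close>

lemma lpath_first_touch:
  assumes "lpath E xs" "hd xs \<notin> S" "set xs \<inter> S \<noteq> {}"
  shows "\<exists>A s t B. xs = A @ s # t # B \<and> odd (length A) \<and> set A \<inter> S = {} \<and> (s \<in> S \<or> t \<in> S)"
  using assms
proof (induction E xs rule: lpath.induct)
  case (4 E a b c xs)
  show ?case
  proof (cases "b \<in> S \<or> c \<in> S")
    case True
    then have "a # b # c # xs = [a] @ b # c # xs" "odd (length [a])" "set [a] \<inter> S = {}" using 4 by auto
    with True show ?thesis by blast
  next
    case False
    then have "lpath E (c # xs)" "hd (c # xs) \<notin> S" "set (c # xs) \<inter> S \<noteq> {}" using 4 by auto
    from 4(1)[OF this] obtain A s t B where *: "c # xs = A @ s # t # B" "odd (length A)" "set A \<inter> S = {}" "s \<in> S \<or> t \<in> S"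
      by blast
    then have "a # b # c # xs = (a # b # A) @ s # t # B" "odd (length (a # b # A))" "set (a # b # A) \<inter> S = {}"
      using False 4 by auto
    with *(4) show ?thesis by blast
  qed
qed auto

lemma lpath_length_ge3: "lpath E xs \<Longrightarrow> hd xs \<noteq> last xs \<Longrightarrow> 3 \<le> length xs"
  by (cases "(E, xs)" rule: lpath.cases) simp_all

(* The edges {hd L, p, q} and {last L, p, q} overlap in two vertices, so together with the path L
   they just fail to form a linear cycle. *)
definition handle :: "'a set set \<Rightarrow> 'a list \<Rightarrow> 'a \<Rightarrow> 'a \<Rightarrow> bool" where
  "handle E L p q \<longleftrightarrow> lpath E L \<and> distinct (p # q # L) \<and> 3 \<le> length L \<and> {hd L, p, q} \<in> E \<and> {last L, p, q} \<in> E"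

lemma handle_rev: "handle E L p q \<Longrightarrow> handle E (rev L) p q"
  by (simp add: handle_def lpath_rev hd_rev last_rev)

section \<open>Landings and good paths\<close>

definition path :: "'a set set \<Rightarrow> 'a list \<Rightarrow> bool" where
  "path E xs \<longleftrightarrow> lpath E xs \<and> distinct xs"

text \<open>The edge landed on is {last ys, w, hd zs}. The bound on \<open>length ys\<close>
  excludes the first edge of \<open>xs\<close> itself, which would qualify trivially.\<close>

definition lands :: "'a set set \<Rightarrow> 'a list \<Rightarrow> 'a list \<Rightarrow> bool" where
  "lands E xs zs \<longleftrightarrow> (\<exists>ys w. xs = ys @ w # zs \<and> odd (length ys) \<and> 3 \<le> length ys \<and> zs \<noteq> [] \<and> {hd xs, w, hd zs} \<in> E)"

(* zs and R are root parts of the path ys @ R; both have odd length, so length zs < length R means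
   that the edge landed on lies within R. *)
definition landing_free :: "'a set set \<Rightarrow> 'a list \<Rightarrow> bool" where
  "landing_free E R \<longleftrightarrow>
    (\<forall>ys zs. ys \<noteq> [] \<longrightarrow> path E (ys @ R) \<longrightarrow> lands E (ys @ R) zs \<longrightarrow> length R \<le> length zs)"

text \<open>For a path without proper extensions landing-freeness is vacuous; the first conjunct
  supplies the extension from which \<open>exists_landing\<close> starts.\<close>

definition good :: "'a set set \<Rightarrow> 'a list \<Rightarrow> bool" where
  "good E R \<longleftrightarrow> (\<exists>x y. path E (x # y # R)) \<and> landing_free E R"

section \<open>Paths and handles in the absence of linear cycles\<close>

locale no_cycle =
  fixes E :: "'a set set"
  assumes no_linear_cycle: "\<not> (\<exists>C\<subseteq>E. linear_cycle C)"
begin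

lemma closing:
  "lpath E ys \<Longrightarrow> distinct (u # ys) \<Longrightarrow> 5 \<le> length ys \<Longrightarrow> {hd ys, u, last ys} \<in> E \<Longrightarrow> False"
  using linear_cycle_of_list[of E ys u] no_linear_cycle by simp

text \<open>The path \<open>A\<close> from \<open>p\<close>, the edge {last A, c, b}, a path inside
  \<open>L\<close> from \<open>b\<close> to its end \<open>z\<close> and the handle edge {z, q, p}
  form a linear cycle. Assumption \<open>len\<close> excludes the case of only two edges.\<close>

lemma handle_touch:
  assumes h: "handle E L p q"
    and A: "lpath E A" "distinct A" "hd A = p" "set A \<inter> set L = {}" "q \<notin> set A"
    and e: "{last A, c, b} \<in> E" "c \<notin> set A" "c \<noteq> q"
    and r: "reaches E L b c z" "z = hd L \<or> z = last L"
    and len: "3 \<le> length A \<or> b \<noteq> z"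
  shows False
proof -
  obtain K where K: "lpath E K" "distinct K" "set K \<subseteq> set L" "hd K = b" "c \<notin> set K" "last K = z"
    using r(1) unfolding reaches_def by blast
  have ne: "A \<noteq> []" "K \<noteq> []" using A(1) K(1) by auto
  have odd: "odd (length A)" "odd (length K)" using A(1) K(1) lpath_odd by auto
  have L: "distinct L" "p \<notin> set L" "q \<notin> set L" "p \<noteq> q" "{hd L, p, q} \<in> E" "{last L, p, q} \<in> E"
    using h unfolding handle_def by auto
  show False
  proof (rule closing)
    show "lpath E (A @ c # K)" using lpath_append[OF odd(1) ne(2)] A(1) K(1,4) e(1) by simp
    show "distinct (q # A @ c # K)" using A K e(2,3) L by auto
    have "3 \<le> length A \<or> 3 \<le> length K" using len lpath_length_ge3[OF K(1)] K by auto
    then show "5 \<le> length (A @ c # K)" using odd by (auto elim!: oddE)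
    show "{hd (A @ c # K), q, last (A @ c # K)} \<in> E"
      using r(2) L(5,6) ne A(3) K(6) by (auto simp: insert_commute)
  qed
qed

text \<open>Consider the first edge of the path that meets \<open>L\<close>. By
  \<open>handle_touch\<close> it cannot be continued to \<open>last L\<close>, so its new vertices
  are an exceptional pair for that end and can be continued to \<open>hd L\<close>. This avoids a
  cycle only if the edge starts at \<open>p\<close> and contains \<open>hd L\<close>.\<close>

lemma handle_first_edge:
  assumes h: "handle E L p q"
    and k: "lpath E (p # k)" "distinct (p # k)" "q \<notin> set k" "last L \<notin> set k" "set k \<inter> set L \<noteq> {}"
  shows "\<exists>v w r c b k'. L = v # w # r \<and> k = c # b # k' \<and> {b, c} = {v, w}"
proof -
  have L: "lpath E L" "distinct L" "p \<notin> set L" "q \<notin> set L" "p \<noteq> q"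
    using h unfolding handle_def by auto
  have "hd (p # k) \<notin> set L" "set (p # k) \<inter> set L \<noteq> {}" using L k by auto
  from lpath_first_touch[OF k(1) this] obtain A s t B where
    B: "p # k = A @ s # t # B" and A: "odd (length A)" "set A \<inter> set L = {}" and st: "s \<in> set L \<or> t \<in> set L"
    by blast
  have ne: "A \<noteq> []" using A by auto
  have hdA: "hd A = p" using B ne by (metis hd_append2 list.sel(1))
  have lA: "lpath E A" and e: "{last A, s, t} \<in> E"
    using k(1) A(1) lpath_append[of A "t # B" E s] unfolding B by auto
  have d: "distinct A" "s \<noteq> t" "s \<notin> set A" "t \<notin> set A" using k(2) unfolding B by auto
  have q: "q \<notin> set (p # k)" using L(5) k(3) by auto
  then have q: "q \<notin> set A" "s \<noteq> q" "t \<noteq> q" unfolding B by auto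
  have lL: "last L \<notin> set (p # k)" using k(4) L(1,3) last_in_set[of L] by (cases "L = []") auto
  then have lL: "s \<noteq> last L" "t \<noteq> last L" unfolding B by auto
  have touch: "\<not> reaches E L b c z" if "(b = s \<and> c = t) \<or> (b = t \<and> c = s)" "z = hd L \<or> z = last L"
    "3 \<le> length A \<or> b \<noteq> z" for b c z
  proof
    assume "reaches E L b c z"
    then show False
      using handle_touch[OF h lA d(1) hdA A(2) q(1), of c b z] that e d(3,4) q by (auto simp: insert_commute)
  qed
  have no: "\<not> reaches E L s t (last L)" "\<not> reaches E L t s (last L)" using touch lL by auto
  then obtain A1 w1 B1 where 1: "L = A1 @ w1 # B1" "odd (length A1)" "B1 \<noteq> []" "{s, t} = {last A1, w1}"
    using lpath_reach_last[OF L(1,2) d(2) st] by blast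
  have "\<not> (\<exists>A w B. L = A @ w # B \<and> odd (length A) \<and> B \<noteq> [] \<and> {s, t} = {w, hd B})"
  proof (intro notI, elim exE conjE)
    fix A w B assume "L = A @ w # B" "odd (length A)" "B \<noteq> []" "{s, t} = {w, hd B}"
    then show False using odd_split_clash[OF L(2), of A w B A1 w1 B1] 1 by auto
  qed
  then have r: "reaches E L s t (hd L) \<or> reaches E L t s (hd L)"
    using lpath_reach_hd[OF L(1,2) d(2) st] by blast
  then have "\<not> 3 \<le> length A" "s = hd L \<or> t = hd L" using touch by blast+
  then have "length A = 1" using A(1) by (auto elim!: oddE)
  then have Ap: "A = [p]" using hdA by (cases A) auto
  have neA1: "A1 \<noteq> []" using 1 by auto
  have "hd L \<in> {last A1, w1}" using 1(4) \<open>s = hd L \<or> t = hd L\<close> by auto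
  moreover have "hd L = hd A1" "hd A1 \<noteq> w1" using 1(1) L(2) neA1 hd_in_set[OF neA1] by auto
  ultimately have "hd A1 = last A1" by auto
  moreover have "distinct A1" using 1(1) L(2) by auto
  ultimately have "A1 = [hd A1]" using neA1
    by (cases A1) (auto split: if_splits)
  then obtain v where v: "A1 = [v]" by blast
  show ?thesis
  proof (intro exI conjI)
    show "L = v # w1 # B1" "{t, s} = {v, w1}" using 1 v by auto
    show "k = s # t # B" using B Ap by simp
  qed
qed

text \<open>If one of \<open>s\<close>, \<open>t\<close> reached \<open>c\<close> avoiding the
  other, that path, the edge {c, b, a} and the edge {a, s, t} would form a linear cycle. The
  exceptional pair left over by \<open>lpath_reach_hd\<close> is a landing.\<close>

lemma tip_edge_lands:
  assumes P: "path E (a # b # c # xs)" and e: "{a, s, t} \<in> E" "s \<noteq> t" "s \<notin> {a, b, c}" "t \<notin> {a, b, c}"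
    and st: "s \<in> set xs \<or> t \<in> set xs"
  shows "\<exists>zs. lands E (a # b # c # xs) zs"
proof -
  have l: "lpath E (c # xs)" "distinct (c # xs)" "{a, b, c} \<in> E" and d: "distinct [a, b, c]" "a \<notin> set xs" "b \<notin> set xs"
    using P unfolding path_def by auto
  have no: "\<not> reaches E (c # xs) s' t' c" if st': "(s' = s \<and> t' = t) \<or> (s' = t \<and> t' = s)" for s' t'
  proof
    assume "reaches E (c # xs) s' t' c"
    then obtain K where K: "lpath E K" "distinct K" "set K \<subseteq> set (c # xs)" "hd K = s'" "t' \<notin> set K" "last K = c"
      unfolding reaches_def by blast
    have odd: "odd (length K)" and ne: "K \<noteq> []" using K(1) lpath_odd by auto
    show False
    proof (rule closing)
      show "lpath E (K @ b # [a])" using lpath_append[OF odd, of "[a]"] K l by (auto simp: insert_commute)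
      show "distinct (t' # K @ b # [a])" using K d e st' by auto
      show "5 \<le> length (K @ b # [a])" using lpath_length_ge3[OF K(1)] K st' e by auto
      show "{hd (K @ b # [a]), t', last (K @ b # [a])} \<in> E" using e K ne st' by (auto simp: insert_commute)
    qed
  qed
  then obtain A w B where *: "c # xs = A @ w # B" "odd (length A)" "B \<noteq> []" "{s, t} = {w, hd B}"
    using lpath_reach_hd[OF l(1,2) e(2)] st by auto
  then have "a # b # c # xs = (a # b # A) @ w # B" "odd (length (a # b # A))" "3 \<le> length (a # b # A)"
    by (auto elim: oddE)
  moreover have "{hd (a # b # c # xs), w, hd B} \<in> E" using e(1) *(4) by (metis insert_commute list.sel(1))
  ultimately show ?thesis unfolding lands_def using *(3) by blast
qed

end

section \<open>Strong degree at least three\<close>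

lemma strong_degree_matching:
  assumes H: "hypergraph3 V E" and d: "3 \<le> strong_degree E v"
  shows "\<exists>M. disjoint M \<and> 3 \<le> card M \<and>
    (\<forall>e\<in>M. \<exists>x y. e = {x, y} \<and> {v, x, y} \<in> E \<and> distinct [v, x, y])"
proof -
  let ?D = "{card M | M. M \<subseteq> link_edges E v \<and> disjoint M}"
  have "link_edges E v \<subseteq> Pow V"
  proof
    fix e assume "e \<in> link_edges E v"
    then obtain x y where "e = {x, y}" "{v, x, y} \<in> E" unfolding link_edges_def by auto
    moreover from this have "{v, x, y} \<subseteq> V" using H unfolding hypergraph3_def by (meson bspec)
    ultimately show "e \<in> Pow V" by auto
  qed
  then have fin: "finite (link_edges E v)"
    using H by (auto simp: hypergraph3_def intro: finite_subset)
  have "?D = card ` {M. M \<subseteq> link_edges E v \<and> disjoint M}" by blast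
  moreover have "finite {M. M \<subseteq> link_edges E v \<and> disjoint M}"
    by (rule finite_subset[of _ "Pow (link_edges E v)"]) (use fin in auto)
  ultimately have "finite ?D" by simp
  moreover have "?D \<noteq> {}" by (auto intro!: exI[of _ "{}"])
  ultimately have "Max ?D \<in> ?D" by (rule Max_in)
  then obtain M where M: "M \<subseteq> link_edges E v" "disjoint M" "card M = strong_degree E v"
    unfolding strong_degree_def by auto
  have "\<exists>x y. e = {x, y} \<and> {v, x, y} \<in> E \<and> distinct [v, x, y]" if e: "e \<in> M" for e
  proof -
    obtain x y where xy: "e = {x, y}" "{v, x, y} \<in> E" using e M(1) unfolding link_edges_def by auto
    then have "card {v, x, y} = 3" using H unfolding hypergraph3_def by (meson bspec)
    then have "distinct [v, x, y]" using card_length[of "[v, x, y]"] card_distinct[of "[v, x, y]"] by simp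
    with xy show ?thesis by blast
  qed
  with M d show ?thesis by (intro exI[of _ M]) auto
qed

text \<open>At most one member of a disjoint family contains \<open>a\<close>.\<close>

lemma disjoint_card_avoiding:
  assumes "disjoint M"
  shows "card M \<le> Suc (card {e \<in> M. a \<notin> e})"
proof (cases "\<exists>e\<in>M. a \<in> e")
  case True
  then obtain e where e: "e \<in> M" "a \<in> e" by blast
  have "{f \<in> M. a \<notin> f} = M - {e}" using e assms unfolding disjoint_def by blast
  then show ?thesis by (simp add: e(1) card_Diff_singleton)
next
  case False
  then have "{e \<in> M. a \<notin> e} = M" by blast
  then show ?thesis by simp
qed

lemma disjoint_sub: "disjoint M \<Longrightarrow> disjoint {e \<in> M. P e}"
  unfolding disjoint_def by blast

lemma lpath_subset:
  "lpath E xs \<Longrightarrow> (\<And>e. e \<in> E \<Longrightarrow> e \<subseteq> V) \<Longrightarrow> 3 \<le> length xs \<Longrightarrow> set xs \<subseteq> V"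
proof (induction E xs rule: lpath.induct)
  case (4 E a b c xs)
  have "{a, b, c} \<subseteq> V" using 4(2) by (intro 4(3)) simp
  moreover have "set xs \<subseteq> V"
    using 4 by (cases "(E, c # xs)" rule: lpath.cases) auto
  ultimately show ?case by simp
qed auto

lemma lpath_even_prefix:
  assumes "lpath E (hs @ p # ys)" "lpath E (p # ys)"
  shows "lpath E (hs @ [p])" "even (length hs)"
proof -
  show "even (length hs)" using lpath_odd[OF assms(1)] lpath_odd[OF assms(2)] by simp
  then show "lpath E (hs @ [p])" using lpath_join[of "hs @ [p]" E ys] assms(1) by simp
qed

locale counterexample = no_cycle E for E :: "'a set set" +
  fixes V :: "'a set"
  assumes hypergraph: "hypergraph3 V E"
    and degree: "v \<in> V \<Longrightarrow> 3 \<le> strong_degree E v"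
begin

section \<open>Edges at the tip and criteria for goodness\<close>

lemma edge_subset: "e \<in> E \<Longrightarrow> e \<subseteq> V"
  using hypergraph unfolding hypergraph3_def by (meson bspec)

text \<open>Of three disjoint link edges, \<open>a\<close> and \<open>b\<close> spoil at most one
  each.\<close>

lemma edge_avoiding:
  assumes "v \<in> V"
  shows "\<exists>x y. {v, x, y} \<in> E \<and> distinct [v, x, y] \<and> a \<notin> {x, y} \<and> b \<notin> {x, y}"
proof -
  obtain M where M: "disjoint M" "3 \<le> card M"
    "\<forall>e\<in>M. \<exists>x y. e = {x, y} \<and> {v, x, y} \<in> E \<and> distinct [v, x, y]"
    using strong_degree_matching[OF hypergraph degree[OF assms]] by blast
  have "0 < card {e \<in> {e \<in> M. a \<notin> e}. b \<notin> e}"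
    using disjoint_card_avoiding[OF M(1), of a] M(2)
      disjoint_card_avoiding[OF disjoint_sub[OF M(1)], of "\<lambda>e. a \<notin> e" b] by linarith
  then obtain e where "e \<in> M" "a \<notin> e" "b \<notin> e"
    using card_gt_0_iff by (metis (mono_tags, lifting) ex_in_conv mem_Collect_eq)
  then show ?thesis using M(3) by metis
qed

text \<open>As \<open>zs\<close> is landing-free, a landing of an extension inside
  \<open>as @ zs\<close> has its middle vertex \<open>w\<close> in \<open>as\<close>. For a short
  explicit list \<open>as\<close> this leaves only a few edges to refute.\<close>

lemma good_intro:
  assumes ext: "path E (x # y # as @ zs)" and zs: "lpath E zs" and ne: "as \<noteq> []"
    and M: "landing_free E zs"
    and bad: "\<And>hs A w B. hs \<noteq> [] \<Longrightarrow> path E (hs @ as @ zs) \<Longrightarrow> as = A @ w # B \<Longrightarrow> odd (length A) \<Longrightarrow>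
      {hd hs, w, hd (B @ zs)} \<in> E \<Longrightarrow> False"
  shows "good E (as @ zs)"
  unfolding good_def landing_free_def
proof (intro conjI exI allI impI)
  show "path E (x # y # as @ zs)" by (fact ext)
next
  fix hs zs'
  assume hs: "hs \<noteq> []" "path E (hs @ as @ zs)" "lands E (hs @ as @ zs) zs'"
  have le: "length zs \<le> length zs'" using M hs unfolding landing_free_def by (metis append.assoc append_is_Nil_conv)
  obtain ys w where ys: "hs @ as @ zs = ys @ w # zs'" "odd (length ys)" "{hd (hs @ as @ zs), w, hd zs'} \<in> E"
    using hs(3) unfolding lands_def by blast
  show "length (as @ zs) \<le> length zs'"
  proof (rule ccontr)
    assume n: "\<not> length (as @ zs) \<le> length zs'"
    have len: "length hs + length as + length zs = length ys + 1 + length zs'"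
      using arg_cong[OF ys(1), of length] by simp
    \<comment> \<open>The landing splits the path beyond \<open>hs\<close>; \<open>us\<close> is the
      part of \<open>as\<close> before the middle vertex.\<close>
    define us where "us = drop (length hs) ys"
    have "length hs \<le> length ys" using n len by simp
    then have "take (length hs) ys = hs"
      using arg_cong[OF ys(1), of "take (length hs)"] by simp
    then have us: "ys = hs @ us"
      unfolding us_def by (metis append_take_drop_id)
    then have asz: "as @ zs = us @ w # zs'" using ys(1) by simp
    define B where "B = drop (length us + 1) as"
    have "length us + 1 \<le> length as" using us le len by simp
    then have "take (length us + 1) as = us @ [w]" "drop (length us + 1) as @ zs = zs'"
      using arg_cong[OF asz, of "take (length us + 1)"] arg_cong[OF asz, of "drop (length us + 1)"] by simp_all
    then have B: "as = us @ w # B" "zs' = B @ zs"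
      unfolding B_def using append_take_drop_id[of "length us + 1" as] by simp_all
    have "odd (length (hs @ as @ zs))" "odd (length (x # y # as @ zs))" "odd (length zs)"
      using hs(2) ext zs lpath_odd unfolding path_def by blast+
    then have "even (length hs)" by simp
    then have "odd (length us)" using ys(2) us by simp
    then show False using bad[OF hs(1,2) B(1)] ys(3) hs(1) B(2) by simp
  qed
qed

text \<open>Otherwise \<open>tip_edge_lands\<close> makes the extension \<open>p # v # zs\<close> of
  \<open>zs\<close> land inside \<open>zs\<close>.\<close>

lemma fresh_at_tip:
  assumes P: "path E (p # v # zs)" "zs \<noteq> []"
    and M: "landing_free E zs"
    and e: "{p, x, y} \<in> E" "distinct [p, x, y]" "v \<notin> {x, y}" "hd zs \<notin> {x, y}"
  shows "x \<notin> set zs" "y \<notin> set zs"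
proof -
  obtain q xs where zs: "zs = q # xs" using P(2) by (cases zs) auto
  have "\<not> (x \<in> set xs \<or> y \<in> set xs)"
  proof
    assume "x \<in> set xs \<or> y \<in> set xs"
    then obtain zs' where l: "lands E (p # v # zs) zs'"
      using tip_edge_lands[of p v q xs x y] P e unfolding zs by auto
    then have "length zs \<le> length zs'" using M P(1) unfolding landing_free_def by (metis append_Cons append_Nil list.distinct(1))
    with l show False unfolding lands_def by (auto dest: arg_cong[where f = length])
  qed
  then show "x \<notin> set zs" "y \<notin> set zs" using e zs by auto
qed

text \<open>By \<open>good_intro\<close> only a landing on {p, v, hd zs} can spoil goodness. If its
  extension \<open>hs\<close> missed \<open>u\<close>, then \<open>hs @ [p]\<close>, the edge {p, u,
  hd zs} and the landing edge would form a linear cycle. In the application \<open>u\<close> and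
  \<open>v\<close> are the two ends of a handle.\<close>

lemma good_or_bad:
  assumes P: "path E (p # v # zs)" "zs \<noteq> []"
    and M: "landing_free E zs"
    and u: "{u, p, hd zs} \<in> E" "u \<notin> set (p # v # zs)"
  shows "good E (p # v # zs) \<or>
    (\<exists>hs. hs \<noteq> [] \<and> path E (hs @ p # v # zs) \<and> {hd hs, v, hd zs} \<in> E \<and> u \<in> set hs)"
proof (rule disjCI)
  assume nb: "\<not> (\<exists>hs. hs \<noteq> [] \<and> path E (hs @ p # v # zs) \<and> {hd hs, v, hd zs} \<in> E \<and> u \<in> set hs)"
  have "p \<in> V" using edge_subset[OF u(1)] by simp
  then obtain x y where e: "{p, x, y} \<in> E" "distinct [p, x, y]" "v \<notin> {x, y}" "hd zs \<notin> {x, y}"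
    using edge_avoiding[of p v "hd zs"] by blast
  have lp: "lpath E (p # v # zs)" "lpath E zs" and d: "distinct (p # v # zs)"
    using P(1) assms(2) unfolding path_def by (cases zs; auto)+
  have "good E ([p, v] @ zs)"
  proof (rule good_intro)
    show "path E (x # y # [p, v] @ zs)"
      using fresh_at_tip[OF P M e] e lp(1) d unfolding path_def by (auto simp: insert_commute)
    show "lpath E zs" "[p, v] \<noteq> []" by (use lp in auto)
  next
    show "landing_free E zs" by (fact M)
  next
    fix hs A w B
    assume hs: "hs \<noteq> []" "path E (hs @ [p, v] @ zs)" and AB: "[p, v] = A @ w # B" "odd (length A)"
      and e': "{hd hs, w, hd (B @ zs)} \<in> E"
    have "w = v" "B = []" using AB by (auto simp: Cons_eq_append_conv)
    with e' have x: "{hd hs, v, hd zs} \<in> E" by simp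
    then have u': "u \<notin> set hs" using nb hs by auto
    have l: "lpath E (hs @ [p])" "even (length hs)" and dh: "distinct (hs @ p # v # zs)"
      using lpath_even_prefix[of E hs p "v # zs"] hs(2) lp(1) unfolding path_def by auto
    show False
    proof (rule closing)
      show "lpath E ((hs @ [p]) @ u # [hd zs])"
        using lpath_append[of "hs @ [p]" "[hd zs]" E u] l u(1) by (simp add: insert_commute)
      show "distinct (v # (hs @ [p]) @ u # [hd zs])" using dh u(2) u' P(2) by (cases zs) auto
      show "5 \<le> length ((hs @ [p]) @ u # [hd zs])" using l(2) hs(1) by (cases hs) (auto elim: oddE)
      show "{hd ((hs @ [p]) @ u # [hd zs]), v, last ((hs @ [p]) @ u # [hd zs])} \<in> E"
        using x hs(1) by simp
    qed
  qed
  then show "good E (p # v # zs)" by simp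
qed

text \<open>Read from \<open>p\<close>, the spoiling extension \<open>hs\<close> of
  \<open>good_or_bad\<close> meets the handle in \<open>hd L\<close> but avoids \<open>q\<close> and
  \<open>last L\<close>, so \<open>handle_first_edge\<close> applies to it.\<close>

lemma bad_first_edge:
  assumes h: "handle E L p q"
    and hs: "hs \<noteq> []" "path E (hs @ p # last L # zs)" "lpath E (p # last L # zs)" "q \<in> set zs" "hd L \<in> set hs"
  shows "\<exists>v w r c b k. L = v # w # r \<and> rev hs = c # b # k \<and> {b, c} = {v, w} \<and>
    {p, v, w} \<in> E \<and> path E (b # k) \<and> set (p # v # w # k) \<inter> {q, last L} = {} \<and> distinct (v # w # p # k)"
proof -
  have l: "lpath E (hs @ [p])" and d: "distinct (hs @ p # last L # zs)"
    using lpath_even_prefix[of E hs p "last L # zs"] hs unfolding path_def by auto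
  have "lpath E (rev (hs @ [p]))" using l lpath_rev by blast
  then have lk: "lpath E (p # rev hs)" by simp
  have "L \<noteq> []" using h unfolding handle_def by auto
  then have "set (rev hs) \<inter> set L \<noteq> {}" using hs(5) by auto
  moreover have "distinct (p # rev hs)" "q \<notin> set (rev hs)" "last L \<notin> set (rev hs)" using d hs(4) by auto
  ultimately obtain v w r c b k where *: "L = v # w # r" "rev hs = c # b # k" "{b, c} = {v, w}"
    using handle_first_edge[OF h lk] by metis
  have e: "{p, c, b} \<in> E" "path E (b # k)" using lk d * unfolding path_def by (auto dest: arg_cong[where f = set] arg_cong[where f = distinct])
  have "{c, b} = {v, w}" using *(3) by auto
  then have "{p, v, w} \<in> E" using e(1) by simp
  moreover have "set (c # b # k) = set hs" "distinct (c # b # k)"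
    using *(2) d set_rev[of hs] distinct_rev[of hs] by simp_all
  then have "p \<notin> set (c # b # k)" "q \<notin> set (c # b # k)" "last L \<notin> set (c # b # k)" "q \<noteq> p" "last L \<noteq> p" "distinct (c # b # k)"
    using d hs(4) by auto
  then have "set (p # v # w # k) \<inter> {q, last L} = {}" "distinct (v # w # p # k)"
    using *(3) by (auto simp: doubleton_eq_iff)
  ultimately show ?thesis using * e by blast
qed

section \<open>Lengthening good paths\<close>

text \<open>A landing edge on either of the two new edges meets the chord {p, z, hd zs} in exactly
  one vertex: \<open>z\<close> for {p, a, b}, \<open>hd zs\<close> for {b, c, hd zs}. Path, chord
  and landing edge then form a linear cycle.\<close>

lemma good_two_edges:
  assumes P: "path E (x # y # p # a # b # c # zs)" "zs \<noteq> []"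
    and M: "landing_free E zs"
    and z: "z \<in> {a, b}" "{p, z, hd zs} \<in> E"
  shows "good E (p # a # b # c # zs)"
proof -
  have lp: "lpath E (p # a # b # c # zs)" "lpath E zs"
    using P unfolding path_def by (cases zs; auto)+
  have "good E ([p, a, b, c] @ zs)"
  proof (rule good_intro)
    show "path E (x # y # [p, a, b, c] @ zs)" using P by simp
    show "lpath E zs" "[p, a, b, c] \<noteq> []" by (use lp in auto)
  next
    show "landing_free E zs" by (fact M)
  next
    fix hs A w B
    assume hs: "hs \<noteq> []" "path E (hs @ [p, a, b, c] @ zs)" and AB: "[p, a, b, c] = A @ w # B" "odd (length A)"
      and e': "{hd hs, w, hd (B @ zs)} \<in> E"
    have l: "lpath E (hs @ [p])" "even (length hs)" and d: "distinct (hs @ p # a # b # c # zs)"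
      using lpath_even_prefix[of E hs p "a # b # c # zs"] hs(2) lp(1) unfolding path_def by auto
    have q: "hd zs \<in> set zs" using P(2) by simp
    have close: False if "{hd hs, u, s} \<in> E" "{p, t, s} \<in> E" "distinct [u, t, s]"
      "{u, t, s} \<subseteq> insert a (insert b (insert c (set zs)))" for u s t
    proof (rule closing)
      show "lpath E ((hs @ [p]) @ t # [s])"
        using lpath_append[of "hs @ [p]" "[s]" E t] l that(2) by simp
      show "distinct (u # (hs @ [p]) @ t # [s])" using d that(3,4) by auto
      show "5 \<le> length ((hs @ [p]) @ t # [s])" using l(2) hs(1) by (cases hs) (auto elim: oddE)
      show "{hd ((hs @ [p]) @ t # [s]), u, last ((hs @ [p]) @ t # [s])} \<in> E"
        using that(1) hs(1) by simp
    qed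
    have "(w = a \<and> B = [b, c]) \<or> (w = c \<and> B = [])"
      using AB by (auto simp: Cons_eq_append_conv)
    then show False
    proof
      assume "w = c \<and> B = []"
      then show False using close[of c "hd zs" z] e' z d q by auto
    next
      assume w: "w = a \<and> B = [b, c]"
      show False
      proof (cases "z = a")
        case True
        then show False using close[of b a "hd zs"] e' z d q w by (auto simp: insert_commute)
      next
        case False
        then show False using close[of a b "hd zs"] e' z d q w by (auto simp: insert_commute)
      qed
    qed
  qed
  then show ?thesis by simp
qed

text \<open>Two disjoint link edges of \<open>p\<close> avoid \<open>q\<close>. If neither gave the
  required edge, both would be 2-subsets of {v, w, t}, which cannot be disjoint.\<close>

lemma handle3_external_edge:
  assumes h: "handle E [v, w, t] p q"
  shows "\<exists>x y. {p, x, y} \<in> E \<and> distinct [p, x, y] \<and> {x, y} \<inter> {q, v, w, t} = {}"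
proof -
  have E: "{v, p, q} \<in> E" "{t, p, q} \<in> E" "{v, w, t} \<in> E" and d: "distinct [p, q, v, w, t]"
    using h unfolding handle_def by auto
  have "p \<in> V" using edge_subset[OF E(1)] by simp
  then obtain M where M: "disjoint M" "3 \<le> card M"
    "\<forall>e\<in>M. \<exists>x y. e = {x, y} \<and> {p, x, y} \<in> E \<and> distinct [p, x, y]"
    using strong_degree_matching[OF hypergraph degree] by blast
  define N where "N = {e \<in> M. q \<notin> e}"
  have "2 \<le> card N" using disjoint_card_avoiding[OF M(1), of q] M(2) unfolding N_def by simp
  then have "\<not> card N \<le> Suc 0" "finite N" by (auto intro: card_ge_0_finite)
  then obtain e1 e2 where e: "e1 \<in> N" "e2 \<in> N" "e1 \<noteq> e2" using card_le_Suc0_iff_eq by blast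
  then have "e1 \<inter> e2 = {}" using M(1) unfolding N_def disjoint_def by blast
  \<comment> \<open>Such an edge forms a linear cycle of length three with {v, w, t} and one of the
    two handle edges.\<close>
  have touch: "False" if "{p, x, y} \<in> E" "distinct [p, x, y]" "x \<in> {v, w, t}" "y \<notin> {q, v, w, t}" for x y
  proof -
    have "x = v \<or> x = w \<or> x = t" using that(3) by blast
    then show False
    proof (elim disjE)
      assume "x = v"
      then show False using closing[of "[p, y, v, w, t]" q] that E d by (auto simp: insert_commute)
    next
      assume "x = w"
      then show False using closing[of "[p, y, w, v, t]" q] that E d by (auto simp: insert_commute)
    next
      assume "x = t"
      then show False using closing[of "[p, y, t, w, v]" q] that E d by (auto simp: insert_commute)
    qed
  qed
  have inside: "\<exists>x y. f = {x, y} \<and> x \<noteq> y \<and> {x, y} \<subseteq> {v, w, t}"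
    if no: "\<not> ?thesis" and f: "f \<in> N" for f
  proof -
    have "f \<in> M" "q \<notin> f" using f unfolding N_def by auto
    then obtain x y where xy: "f = {x, y}" "{p, x, y} \<in> E" "distinct [p, x, y]" "q \<notin> {x, y}"
      using M(3) by metis
    have yx: "{p, y, x} \<in> E" "distinct [p, y, x]" using xy by (auto simp: insert_commute)
    have "x \<in> {v, w, t} \<or> y \<in> {v, w, t}" using no xy by auto
    then have "x \<in> {v, w, t} \<and> y \<in> {v, w, t}"
      using touch[OF xy(2,3)] touch[OF yx] xy(4) by auto
    then show ?thesis using xy by auto
  qed
  show ?thesis
  proof (rule ccontr)
    assume no: "\<not> ?thesis"
    obtain x1 y1 where 1: "e1 = {x1, y1}" "x1 \<noteq> y1" "{x1, y1} \<subseteq> {v, w, t}" using inside[OF no e(1)] by blast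
    obtain x2 y2 where 2: "e2 = {x2, y2}" "x2 \<noteq> y2" "{x2, y2} \<subseteq> {v, w, t}" using inside[OF no e(2)] by blast
    show False using 1 2 \<open>e1 \<inter> e2 = {}\<close> by auto
  qed
qed

(* For {b, c} = {v, w}, the path p # c # b # k and the edge {last (b # k), t, q}
   witness that passing from q to p by the edge {q, t, p} does not give a good path; the edge {p, t, w'}
   comes from the same failure for {q, v, p}. *)
lemma handle_impossible:
  assumes h: "handle E (v # w # r) p q" and r: "r = r' @ [w', t]"
    and e: "{p, v, w} \<in> E" "{p, t, w'} \<in> E" "{last (b # k), t, q} \<in> E" "b \<in> {v, w}"
    and k: "path E (b # k)" "set (p # v # w # k) \<inter> {q, t} = {}" "distinct (v # w # p # k)"
  shows False
proof -
  have L: "lpath E (v # w # r)" "distinct (p # q # v # w # r' @ [w', t])" "{v, p, q} \<in> E"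
    using h r unfolding handle_def by auto
  have odd: "odd (length (b # k))" using k(1) lpath_odd unfolding path_def by blast
  have lk: "lpath E (rev (b # k))" using k(1) lpath_rev unfolding path_def by blast
  show False
  proof (cases "k = []")
    case True
    show False
    proof (cases "b = v")
      case b: True
      show False using closing[of "[v, w, p, w', t]" q] L e b True by (auto simp: insert_commute)
    next
      case False
      then have b: "b = w" using e by auto
      \<comment> \<open>Here {w, t, q} is an edge and closes \<open>L\<close> with its first two
        vertices swapped.\<close>
      obtain x xs where x: "r = x # xs" using r by (cases r; cases r') auto
      have "lpath E (w # v # r)" using L(1) unfolding x by (auto simp: insert_commute)
      moreover have "5 \<le> length (w # v # r)" using lpath_odd[OF L(1)] r by (auto elim!: oddE)
      ultimately show False using closing[of "w # v # r" q] L e b True r by (auto simp: insert_commute)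
    qed
  next
    case kne: False
    have len: "3 \<le> length (b # k)" using kne odd by (cases k) (auto elim!: oddE)
    show False
    proof (cases "b = v")
      case b: True
      show False
      proof (rule closing)
        show "lpath E (rev (b # k) @ p # [q])"
          using lpath_append[of "rev (b # k)" "[q]" E p] odd lk L(3) b by simp
        show "distinct (t # rev (b # k) @ p # [q])" using k L(2) b by auto
        show "5 \<le> length (rev (b # k) @ p # [q])" using len by simp
        show "{hd (rev (b # k) @ p # [q]), t, last (rev (b # k) @ p # [q])} \<in> E"
          using e(3) kne by (simp add: hd_append hd_rev)
      qed
    next
      case False
      then have b: "b = w" using e by auto
      show False
      proof (cases "w' \<in> set k")
        case w': False
        show False
        proof (rule closing)
          show "lpath E (rev (b # k) @ v # [p, w', t])"
            using lpath_append[of "rev (b # k)" "[p, w', t]" E v] odd lk b e by (simp add: insert_commute)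
          show "distinct (q # rev (b # k) @ v # [p, w', t])" using k L(2) b w' by auto
          show "5 \<le> length (rev (b # k) @ v # [p, w', t])" using len by simp
          show "{hd (rev (b # k) @ v # [p, w', t]), q, last (rev (b # k) @ v # [p, w', t])} \<in> E"
            using e(3) kne by (simp add: hd_append hd_rev insert_commute)
        qed
      next
        case w': True
        have q: "q \<notin> set (rev (b # k))" "w' \<noteq> q" using k L(2) b by auto
        \<comment> \<open>Since \<open>q\<close> lies outside this path, avoiding it costs nothing;
          \<open>reaches\<close> just yields a path from w' to \<open>w\<close>, which {w, v, p} and
          {p, t, w'} close.\<close>
        have "distinct (rev (b # k))" using k(1) unfolding path_def by simp
        moreover have "w' \<in> set (rev (b # k)) \<or> q \<in> set (rev (b # k))" using w' by simp
        moreover have "\<not> reaches E (rev (b # k)) q w' (last (rev (b # k)))"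
        proof
          assume "reaches E (rev (b # k)) q w' (last (rev (b # k)))"
          then obtain K where "lpath E K" "set K \<subseteq> set (rev (b # k))" "hd K = q" unfolding reaches_def by blast
          moreover from this have "K \<noteq> []" by auto
          ultimately show False using q hd_in_set[of K] by blast
        qed
        moreover have "\<not> (\<exists>A u B. rev (b # k) = A @ u # B \<and> odd (length A) \<and> B \<noteq> [] \<and> {w', q} = {last A, u})"
        proof (intro notI, elim exE conjE)
          fix A u B assume *: "rev (b # k) = A @ u # B" "odd (length A)" "{w', q} = {last A, u}"
          then have "A \<noteq> []" by auto
          then have "{last A, u} \<subseteq> set (rev (b # k))" unfolding *(1) by auto
          with q *(3) show False by auto
        qed
        ultimately have "reaches E (rev (b # k)) w' q (last (rev (b # k)))"
          using lpath_reach_last[OF lk _ q(2)] by blast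
        then obtain K where K: "lpath E K" "distinct K" "set K \<subseteq> set (rev (b # k))" "hd K = w'" "last K = w"
          unfolding reaches_def using b by auto
        have Kne: "K \<noteq> []" using K(1) by auto
        show False
        proof (rule closing)
          show "lpath E (K @ v # [p])"
            using lpath_append[of K "[p]" E v] lpath_odd[OF K(1)] K e by (simp add: insert_commute)
          show "distinct (t # K @ v # [p])" using k L(2) b K by auto
          have "w' \<noteq> w" using L(2) by auto
          then show "5 \<le> length (K @ v # [p])" using lpath_length_ge3[OF K(1)] K by simp
          show "{hd (K @ v # [p]), t, last (K @ v # [p])} \<in> E"
            using e(2) K(4) Kne by (simp add: insert_commute)
        qed
      qed
    qed
  qed
qed

text \<open>The candidates for \<open>as\<close> are \<open>[p, last L]\<close>,
  \<open>[p, hd L]\<close> and, if \<open>L\<close> has three vertices, a list of \<open>p\<close>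
  and these. If the first two fail, their spoiling extensions leave \<open>p\<close> towards the
  first and the last edge of \<open>L\<close> respectively, which \<open>handle_impossible\<close>
  refutes for longer \<open>L\<close>.\<close>

lemma good_extends_at_landing:
  assumes P: "path E (L @ p # zs)" "odd (length L)" "3 \<le> length L" "zs \<noteq> []" "{hd L, p, hd zs} \<in> E"
    and M: "landing_free E zs"
  shows "\<exists>as. as \<noteq> [] \<and> good E (as @ zs)"
proof (rule ccontr)
  assume no: "\<not> ?thesis"
  then have ng: "\<not> good E (as @ zs)" if "as \<noteq> []" for as using that by blast
  define q where "q = hd zs"
  have q: "q \<in> set zs" using P(4) unfolding q_def by simp
  have lL: "lpath E L" "{last L, p, q} \<in> E" "lpath E zs" and d: "distinct (L @ p # zs)"
    using P(1) lpath_append[OF P(2,4)] unfolding path_def q_def by auto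
  have hL: "{hd L, p, q} \<in> E" using P(5) unfolding q_def .
  have h: "handle E L p q" unfolding handle_def using lL hL P(3) d q by auto
  have hr: "handle E (rev L) p q" by (rule handle_rev[OF h])
  have Lne: "L \<noteq> []" using P(3) by auto
  have hl: "hd L \<in> set L" "last L \<in> set L" "hd L \<noteq> last L"
    using Lne P(3) d by (auto simp: hd_conv_nth last_conv_nth nth_eq_iff_index_eq)
  obtain zs0 where zs0: "zs = q # zs0" using P(4) unfolding q_def by (cases zs) auto
  have Pl: "path E (p # last L # zs)" and Ph: "path E (p # hd L # zs)"
    using lL hL d hl unfolding path_def zs0 by (auto simp: insert_commute)
  have fresh: "hd L \<notin> set (p # last L # zs)" "last L \<notin> set (p # hd L # zs)" using d hl by auto
  obtain hs where hs: "hs \<noteq> []" "path E (hs @ p # last L # zs)" "{hd hs, last L, q} \<in> E" "hd L \<in> set hs"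
    using good_or_bad[OF Pl P(4) M hL[unfolded q_def] fresh(1)] ng[of "[p, last L]"] unfolding q_def by auto
  obtain gs where gs: "gs \<noteq> []" "path E (gs @ p # hd L # zs)" "last L \<in> set gs"
    using good_or_bad[OF Ph P(4) M lL(2)[unfolded q_def] fresh(2)] ng[of "[p, hd L]"] unfolding q_def by auto
  obtain v w r c b k where 1: "L = v # w # r" "rev hs = c # b # k" "{b, c} = {v, w}" "{p, v, w} \<in> E" "path E (b # k)"
    "set (p # v # w # k) \<inter> {q, last L} = {}" "distinct (v # w # p # k)"
    using bad_first_edge[OF h hs(1,2) _ q hs(4)] Pl unfolding path_def by metis
  have "\<exists>v' w' r'. rev L = v' # w' # r' \<and> {p, v', w'} \<in> E"
    using bad_first_edge[OF hr gs(1) _ _ q] gs(2,3) Ph Lne unfolding path_def by (metis hd_rev last_rev)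
  then obtain t w' r' where 2: "rev L = t # w' # r'" "{p, t, w'} \<in> E" by blast
  have t: "last L = t" using 2(1) Lne by (metis hd_rev list.sel(1))
  have L2: "L = rev r' @ [w', t]" using arg_cong[OF 2(1), of rev] by simp
  have "last (b # k) = last (rev hs)" using 1(2) by simp
  then have x: "{last (b # k), t, q} \<in> E" using hs(1,3) t by (simp add: last_rev)
  have b: "b \<in> {v, w}" using 1(3) by auto
  show False
  \<comment> \<open>This is the case of a handle on five vertices, where \<open>L\<close> is a
    single edge.\<close>
  proof (cases "length r' = 1")
    case False
    have "length r' + 2 = length r + 2" using arg_cong[OF L2, of length] 1(1) by simp
    moreover have "odd (length r')" using L2 P(2) by simp
    ultimately have "2 < length r" using False by (auto elim!: oddE)
    then have "r = drop 2 (rev r') @ [w', t]" using arg_cong[OF L2, of "drop 2"] 1(1) \<open>length r' + 2 = length r + 2\<close> by simp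
    then show False
      using handle_impossible[OF h[unfolded 1(1)] _ 1(4) 2(2) x b 1(5) 1(6)[unfolded t] 1(7)] by blast
  next
    case True
    then have L3: "r = [t]" "w' = w" "L = [v, w, t]" using L2 1(1) by (cases r'; auto)+
    \<comment> \<open>Once \<open>k\<close> is empty, \<open>x\<close> says that {b, t, q} is an
      edge, the one that leads from \<open>q\<close> into the handle below.\<close>
    have k0: "k = []"
    proof (rule ccontr)
      assume kne: "k \<noteq> []"
      have odd: "odd (length (b # k))" and lk: "lpath E (rev (b # k))"
        using 1(5) lpath_odd[of E "b # k"] lpath_rev[of E "b # k"] unfolding path_def by auto
      have len: "3 \<le> length (b # k)" using kne odd by (cases k) (auto elim!: oddE)
      have dd: "distinct [p, q, v, w, t]" "{v, w, t} \<in> E" "{v, p, q} \<in> E" using h unfolding L3 handle_def by auto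
      show False
      proof (cases "b = v")
        case b: True
        show False
        proof (rule closing)
          show "lpath E (rev (b # k) @ p # [q])"
            using lpath_append[of "rev (b # k)" "[q]" E p] odd lk dd(3) b by simp
          show "distinct (t # rev (b # k) @ p # [q])" using 1(6,7) 1(5) dd b t unfolding path_def by auto
          show "5 \<le> length (rev (b # k) @ p # [q])" using len by simp
          show "{hd (rev (b # k) @ p # [q]), t, last (rev (b # k) @ p # [q])} \<in> E"
            using x kne by (simp add: hd_append hd_rev)
        qed
      next
        case False
        then have b: "b = w" using b by auto
        show False
        proof (rule closing)
          show "lpath E (rev (b # k) @ v # [t])"
            using lpath_append[of "rev (b # k)" "[t]" E v] odd lk dd(2) b by (simp add: insert_commute)
          show "distinct (q # rev (b # k) @ v # [t])" using 1(6,7) 1(5) dd b t unfolding path_def by auto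
          show "5 \<le> length (rev (b # k) @ v # [t])" using len by simp
          show "{hd (rev (b # k) @ v # [t]), q, last (rev (b # k) @ v # [t])} \<in> E"
            using x kne by (simp add: hd_append hd_rev insert_commute)
        qed
      qed
    qed
    \<comment> \<open>This edge provides the proper extension that goodness of the two-edge
      candidate demands.\<close>
    obtain x' y' where e: "{p, x', y'} \<in> E" "distinct [p, x', y']" "{x', y'} \<inter> {q, v, w, t} = {}"
      using handle3_external_edge[OF h[unfolded L3(3)]] by blast
    have "x' \<notin> set zs" "y' \<notin> set zs"
      using fresh_at_tip[OF Pl P(4) M e(1,2)] e(3) t unfolding q_def by auto
    then have ext: "path E (x' # y' # p # a # b # c # zs)"
      if "{a, b, c} = {v, w, t}" "distinct [a, b, c]" "{p, a, b} \<in> E" "{b, c, q} \<in> E" for a b c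
    proof -
      have "{a, b, c} \<inter> set zs = {}" "p \<notin> {a, b, c}" "{a, b, c} \<inter> {x', y'} = {}"
        unfolding that(1) using d L3(3) e(3) by auto
      then show ?thesis
        using that(2,3,4) e \<open>x' \<notin> set zs\<close> \<open>y' \<notin> set zs\<close> lL(3) d zs0
        unfolding path_def by (auto simp: insert_commute)
    qed
    have dv: "distinct [v, w, t]" using d L3(3) by simp
    show False
    proof (cases "b = v")
      case True
      then have "path E (x' # y' # p # w # t # v # zs)"
        using ext[of w t v] dv 2(2) x k0 L3(2) by (auto simp: insert_commute)
      then have "good E (p # w # t # v # zs)"
        using good_two_edges[of x' y' p w t v zs t] P(4) M lL(2) t unfolding q_def by (auto simp: insert_commute)
      then show False using ng[of "[p, w, t, v]"] by simp
    next
      case False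
      then have "path E (x' # y' # p # v # w # t # zs)"
        using ext[of v w t] dv 1(4) x k0 b by (auto simp: insert_commute)
      then have "good E (p # v # w # t # zs)"
        using good_two_edges[of x' y' p v w t zs v] P(4) M hL L3(3) unfolding q_def by (auto simp: insert_commute)
      then show False using ng[of "[p, v, w, t]"] by simp
    qed
  qed
qed


section \<open>Unbounded growth of good paths\<close>

lemma path_bounded:
  assumes "path E xs"
  shows "length xs \<le> card V + 2"
\<comment> \<open>A one-vertex path need not lie in \<open>V\<close>; the summand 2 covers
  it.\<close>
proof (cases "3 \<le> length xs")
  case True
  have "set xs \<subseteq> V" using lpath_subset[of E xs V] assms True edge_subset unfolding path_def by simp
  moreover have "finite V" using hypergraph unfolding hypergraph3_def by simp
  ultimately have "card (set xs) \<le> card V" by (simp add: card_mono)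
  then show ?thesis using assms distinct_card[of xs] unfolding path_def by simp
qed simp

text \<open>At the tip of a longest extension of \<open>R\<close>, an edge avoiding \<open>b\<close>
  and \<open>c\<close> must meet the rest of the path.\<close>

lemma exists_landing:
  assumes "good E R"
  shows "\<exists>ys zs. ys \<noteq> [] \<and> path E (ys @ R) \<and> lands E (ys @ R) zs"
proof -
  obtain x y where xy: "path E ([x, y] @ R)" using assms unfolding good_def by auto
  then have R: "R \<noteq> []" unfolding path_def by auto
  have "\<exists>ys. (ys \<noteq> [] \<and> path E (ys @ R)) \<and> (\<forall>xs. xs \<noteq> [] \<and> path E (xs @ R) \<longrightarrow> length xs \<le> length ys)"
  proof (rule ex_has_greatest_nat[of _ "[x, y]" _ "card V + 3"])
    show "[x, y] \<noteq> [] \<and> path E ([x, y] @ R)" using xy by simp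
    show "\<forall>ys. ys \<noteq> [] \<and> path E (ys @ R) \<longrightarrow> length ys < card V + 3"
      using path_bounded by fastforce
  qed
  then obtain ys where ys: "ys \<noteq> []" "path E (ys @ R)"
    and max: "\<And>xs. xs \<noteq> [] \<Longrightarrow> path E (xs @ R) \<Longrightarrow> length xs \<le> length ys" by blast
  obtain a as where a: "ys = a # as" using ys(1) by (cases ys) auto
  obtain b c xs where abc: "ys @ R = a # b # c # xs"
    using ys(2) R a unfolding path_def by (cases "(E, ys @ R)" rule: lpath.cases) auto
  have "{a, b, c} \<in> E" using ys(2) unfolding abc path_def by simp
  then have "a \<in> V" using edge_subset by auto
  then obtain s t where st: "{a, s, t} \<in> E" "distinct [a, s, t]" "b \<notin> {s, t}" "c \<notin> {s, t}"
    using edge_avoiding[of a b c] by blast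
  have "s \<in> set xs \<or> t \<in> set xs"
  proof (rule ccontr)
    assume n: "\<not> (s \<in> set xs \<or> t \<in> set xs)"
    have "path E (s # t # a # b # c # xs)"
      using n st ys(2) unfolding abc path_def by (auto simp: insert_commute)
    then have "path E ((s # t # ys) @ R)" using abc by simp
    then show False using max[of "s # t # ys"] by simp
  qed
  then have "\<exists>zs. lands E (ys @ R) zs"
    using tip_edge_lands[of a b c xs s t] ys(2) st unfolding abc by auto
  with ys show ?thesis by blast
qed

text \<open>The landing with shortest \<open>zs\<close> among all extensions of \<open>R\<close>
  makes \<open>zs\<close> landing-free, because an extension \<open>hs\<close> of
  \<open>zs = us @ R\<close> is the extension \<open>hs @ us\<close> of \<open>R\<close>.\<close>

lemma good_longer:
  assumes "good E R"
  shows "\<exists>R'. good E R' \<and> length R < length R'"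
proof -
  let ?Q = "\<lambda>n. \<exists>ys zs. ys \<noteq> [] \<and> path E (ys @ R) \<and> lands E (ys @ R) zs \<and> length zs = n"
  have "\<exists>n. ?Q n" using exists_landing[OF assms] by blast
  then have "?Q (LEAST n. ?Q n)" by (rule LeastI_ex)
  then obtain ys zs where ys: "ys \<noteq> []" "path E (ys @ R)" "lands E (ys @ R) zs" "length zs = (LEAST n. ?Q n)"
    by blast
  have least: "length zs \<le> length zs'" if "xs \<noteq> []" "path E (xs @ R)" "lands E (xs @ R) zs'" for xs zs'
    unfolding ys(4) by (rule Least_le) (use that in blast)
  obtain L p where L: "ys @ R = L @ p # zs" "odd (length L)" "3 \<le> length L" "zs \<noteq> []" "{hd (ys @ R), p, hd zs} \<in> E"
    using ys(3) unfolding lands_def by blast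
  have le: "length R \<le> length zs" using assms ys(1-3) unfolding good_def landing_free_def by blast
  define us where "us = take (length zs - length R) zs"
  have "R = drop (length ys) (L @ p # zs)" using L(1) by (metis append_eq_conv_conj)
  moreover have "length ys = length L + 1 + (length zs - length R)"
    using arg_cong[OF L(1), of length] le by simp
  ultimately have "R = drop (length zs - length R) zs" by simp
  then have zs: "zs = us @ R" unfolding us_def by (metis append_take_drop_id)
  have "landing_free E zs"
    unfolding landing_free_def
  proof (intro allI impI)
    fix hs zs' assume "hs \<noteq> []" "path E (hs @ zs)" "lands E (hs @ zs) zs'"
    then show "length zs \<le> length zs'" using least[of "hs @ us" zs'] zs by simp
  qed
  moreover have "{hd L, p, hd zs} \<in> E" using L by (cases L) auto
  ultimately obtain as where "as \<noteq> []" "good E (as @ zs)"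
    using good_extends_at_landing[of L p zs] ys(2) L(1-4) by auto
  then show ?thesis using le by (intro exI[of _ "as @ zs"]) (cases as; auto)
qed

lemma no_vertices: "V = {}"
proof (rule ccontr)
  assume "V \<noteq> {}"
  then obtain r where r: "r \<in> V" by blast
  then obtain x y where "{r, x, y} \<in> E" "distinct [r, x, y]"
    using edge_avoiding[of r] by blast
  then have "path E (x # y # [r])" unfolding path_def by (auto simp: insert_commute)
  \<comment> \<open>The root part left by a landing is nonempty, hence not shorter than
    \<open>[r]\<close>.\<close>
  moreover have "landing_free E [r]" unfolding landing_free_def lands_def by (auto simp: Suc_le_eq)
  ultimately have base: "good E [r]" unfolding good_def by blast
  have "\<exists>R. good E R \<and> n \<le> length R" for n
  proof (induction n)
    case 0
    show ?case using base by blast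
  next
    case (Suc n)
    then show ?case using good_longer by (metis Suc_leI le_less_trans)
  qed
  then obtain R where R: "good E R" "card V + 3 \<le> length R" by blast
  then obtain x y where "path E (x # y # R)" unfolding good_def by blast
  from path_bounded[OF this] R(2) show False by simp
qed

end

theorem theorem1p3:
  fixes V :: "'a set" and E :: "'a set set"
  assumes "hypergraph3 V E"
    and "V \<noteq> {}"
    and "\<And>v. v \<in> V \<Longrightarrow> strong_degree E v \<ge> 3"
  shows "\<exists>C. C \<subseteq> E \<and> linear_cycle C"
proof (rule ccontr)
  assume "\<not> ?thesis"
  then interpret counterexample E V
    using assms by unfold_locales auto
  show False using no_vertices assms(2) by blast
qed

end
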